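(* There exist two symmetric probability measures $\mu,\nu$ on $\mathbb R$ and sequences of probability measures $(\mu_n)_n$, $(\nu_n)_n$ on $\mathbb R$ that converge weakly to $\mu$ and $\nu$ respectively, such that optimal plans $\pi_n$ between $\mu_n$ and $\nu_n$ for the squared distance Gromov--Wasserstein problem $$\min_{\pi\in\Pi(\mu_n,\nu_n)}\int\int\big|(x-x')^2-(y-y')^2\big|^2\,d\pi(x,y)\,d\pi(x',y')$$ are never a monotone rearrangement (neither non-decreasing nor non-increasing) between $\mu_n$ and $\nu_n$.
   Context: $\Pi(\mu,\nu)$ is the set of probability measures on $\mathbb R\times\mathbb R$ with marginals $\mu$ and $\nu$. The non-decreasing rearrangement between $\mu$ and $\nu$ is the law of $(F_\mu^{-1}(U),F_\nu^{-1}(U))$ and the non-increasing rearrangement is the law of $(F_\mu^{-1}(U),F_\nu^{-1}(1-U))$, with $U$ uniform on $(0,1)$ and $F^{-1}$ the quantile functions. A measure on $\mathbb R$ is symmetric if it is invariant under reflection about its barycenter. (Degenerate measures such as Dirac masses are allowed for $\mu$ and $\nu$.) *)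

theory Defs
  imports "HOL-Probability.Probability"
begin

definition barycenter :: "real measure \<Rightarrow> real" where
  "barycenter M = (LINT x|M. x)"

text \<open>Integrability of the identity ensures that the barycenter is meaningful, as the Bochner
  integral of a non-integrable function is 0 by convention.\<close>

definition symmetric_measure :: "real measure \<Rightarrow> bool" where
  "symmetric_measure M \<longleftrightarrow>
     integrable M (\<lambda>x. x) \<and> distr M borel (\<lambda>x. 2 * barycenter M - x) = M"

definition couplings :: "real measure \<Rightarrow> real measure \<Rightarrow> (real \<times> real) measure set" where
  "couplings M N = {P. prob_space P \<and> sets P = sets borel \<and>
                       distr P borel fst = M \<and> distr P borel snd = N}"

definition quantile :: "real measure \<Rightarrow> real \<Rightarrow> real" where
  "quantile M u = Inf {x. u \<le> cdf M x}"

definition nondecreasing_rearrangement ::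
    "real measure \<Rightarrow> real measure \<Rightarrow> (real \<times> real) measure" where
  "nondecreasing_rearrangement M N =
     distr (restrict_space lborel {0<..<1}) borel (\<lambda>u. (quantile M u, quantile N u))"

definition nonincreasing_rearrangement ::
    "real measure \<Rightarrow> real measure \<Rightarrow> (real \<times> real) measure" where
  "nonincreasing_rearrangement M N =
     distr (restrict_space lborel {0<..<1}) borel (\<lambda>u. (quantile M u, quantile N (1 - u)))"

text \<open>The cost takes values in the extended nonnegative reals, so that it is also meaningful
  (possibly infinite) without moment assumptions on the marginals.\<close>

definition gw_cost :: "(real \<times> real) measure \<Rightarrow> ennreal" where
  "gw_cost P =
     (\<integral>\<^sup>+ (x', y'). (\<integral>\<^sup>+ (x, y). ennreal (\<bar>(x - x')\<^sup>2 - (y - y')\<^sup>2\<bar>\<^sup>2) \<partial>P) \<partial>P)"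

definition gw_optimal_plan :: "real measure \<Rightarrow> real measure \<Rightarrow> (real \<times> real) measure \<Rightarrow> bool" where
  "gw_optimal_plan M N P \<longleftrightarrow> is_arg_min gw_cost (\<lambda>Q. Q \<in> couplings M N) P"

end

theory Submission
  imports Defs
begin

text \<open>
  Let \<open>\<nu>\<close> have mass \<open>1/8\<close> at \<open>-s\<close>, \<open>3/4\<close> at \<open>0\<close> and \<open>1/8\<close> at \<open>s\<close>, and let \<open>\<mu>\<close> be its image
  under the absolute value. A coupling is determined by the masses \<open>d\<close> and \<open>e\<close> it gives to \<open>(0, s)\<close>
  and \<open>(0, -s)\<close>, and its cost is \<open>s\<^sup>4 (1/2 + 2 (d + e) - 8 (d - e)\<^sup>2)\<close>. As \<open>d\<close> and \<open>e\<close> are at most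
  \<open>1/8\<close>, the unique minimum is at \<open>d = e = 0\<close>, that is, at the law of \<open>(\<bar>y\<bar>, y)\<close>. This plan charges
  both \<open>(s, s)\<close> and \<open>(s, -s)\<close>, whereas the non-increasing rearrangement misses the former and the
  non-decreasing one the latter. Letting \<open>s\<close> tend to \<open>0\<close>, both marginals converge to the Dirac mass
  at \<open>0\<close>.
\<close>

section \<open>Measures carried by finitely many points\<close>

lemma nn_integral_finite_support:
  fixes P :: "'a measure" and f :: "'a \<Rightarrow> ennreal"
  assumes "finite S" and "AE z in P. z \<in> S" and sing: "\<And>z. z \<in> S \<Longrightarrow> {z} \<in> sets P"
  shows "(\<integral>\<^sup>+z. f z \<partial>P) = (\<Sum>z\<in>S. f z * emeasure P {z})"
proof -
  \<comment> \<open>Off a null set \<open>f\<close> agrees with a simple function, which is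
    measurable even if \<open>f\<close> is not.\<close>
  have "(\<integral>\<^sup>+z. f z \<partial>P) = (\<integral>\<^sup>+z. (\<Sum>w\<in>S. f w * indicator {w} z) \<partial>P)"
  proof (rule nn_integral_cong_AE, use assms(2) in eventually_elim)
    fix z assume "z \<in> S"
    have "(\<Sum>w\<in>S. f w * indicator {w} z) = (\<Sum>w\<in>S. if w = z then f w else 0)"
      by (rule sum.cong) (auto simp: indicator_def)
    then show "f z = (\<Sum>w\<in>S. f w * indicator {w} z)"
      using \<open>finite S\<close> \<open>z \<in> S\<close> by simp
  qed
  also have "\<dots> = (\<Sum>w\<in>S. f w * emeasure P {w})"
    using sing by (subst nn_integral_sum) (auto intro!: sum.cong nn_integral_cmult_indicator)
  finally show ?thesis .
qed

lemma (in finite_measure) measure_finite_support: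
  assumes "finite S" and "AE z in M. z \<in> S" and sing: "\<And>z. z \<in> S \<Longrightarrow> {z} \<in> sets M"
    and "A \<in> sets M"
  shows "measure M A = (\<Sum>z\<in>S \<inter> A. measure M {z})"
proof -
  have "S \<in> sets M"
    using sets.finite_UN[of S "\<lambda>z. {z}" M] assms by simp
  then have "measure M A = measure M (S \<inter> A)"
    using assms by (intro measure_eq_AE) auto
  then show ?thesis
    using finite_measure_eq_sum_singleton[of "S \<inter> A"] assms by simp
qed

section \<open>Weak convergence to a Dirac mass, and quantiles\<close>

lemma real_distribution_return: "real_distribution (return borel a)"
  by (simp add: real_distribution_def real_distribution_axioms_def prob_space_return)

text \<open>On a fixed probability space, pointwise convergence passes through a bounded continuous
  test function, and dominated convergence gives convergence of the integrals.\<close>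

lemma weak_conv_m_distr_return_0:
  fixes X :: "nat \<Rightarrow> 'a \<Rightarrow> real"
  assumes "prob_space D" and [measurable]: "\<And>n. X n \<in> borel_measurable D"
    and lim: "\<And>\<omega>. (\<lambda>n. X n \<omega>) \<longlonglongrightarrow> 0"
  shows "weak_conv_m (\<lambda>n. distr D borel (X n)) (return borel 0)"
proof -
  interpret D: prob_space D by fact
  show ?thesis
  proof (rule integral_bdd_continuous_conv_imp_weak_conv)
    show "real_distribution (distr D borel (X n))" for n
      by (intro D.real_distribution_distr) auto
    show "real_distribution (return borel 0)"
      by (rule real_distribution_return)
    fix f :: "real \<Rightarrow> real"
    assume cont: "\<And>x. isCont f x" and bound: "\<And>x. \<bar>f x\<bar> \<le> 1"
    have [measurable]: "f \<in> borel_measurable borel"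
      using cont by (intro borel_measurable_continuous_onI continuous_at_imp_continuous_on) auto
    have "(\<lambda>n. LINT \<omega>|D. f (X n \<omega>)) \<longlonglongrightarrow> (LINT \<omega>|D. f 0)"
      using bound isCont_tendsto_compose[OF cont lim]
      by (intro integral_dominated_convergence[where w="\<lambda>_. 1"]) auto
    then show "(\<lambda>n. integral\<^sup>L (distr D borel (X n)) f) \<longlonglongrightarrow> integral\<^sup>L (return borel 0) f"
      by (simp add: integral_distr integral_return D.prob_space)
  qed
qed

text \<open>The cdf is monotone and right-continuous, so for 0 < u < 1 the set whose infimum is
  taken is a closed half-line and contains its infimum.\<close>

lemma quantile_le_iff:
  assumes "real_distribution M" "0 < u" "u < 1"
  shows "quantile M u \<le> x \<longleftrightarrow> u \<le> cdf M x"
proof -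
  interpret cdf_distribution M
    using assms(1) by (simp add: cdf_distribution_def)
  show ?thesis
    unfolding quantile_def by (rule pseudoinverse[symmetric, OF assms(2,3)])
qed

text \<open>Holds for arbitrary \<open>f\<close>: the mass is either that of the preimage or the
  default 0, and both vanish if the preimage is empty. It thus applies to quantile maps directly: a
  rearrangement charges only points attained at some level u.\<close>

lemma distr_singleton_nonzeroE:
  assumes "measure (distr M N f) {z} \<noteq> 0"
  obtains u where "u \<in> space M" "f u = z"
proof -
  have "f -` {z} \<inter> space M \<noteq> {}"
  proof
    assume "f -` {z} \<inter> space M = {}"
    then have "emeasure (distr M N f) {z} = 0"
      by (simp add: distr_def emeasure_measure_of_conv)
    then show False
      using assms by (simp add: measure_def)
  qed
  then show thesis
    using that by blast
qed

section \<open>The two marginals\<close>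

definition three_point :: "real \<Rightarrow> nat \<Rightarrow> real" where
  "three_point s k = (if k = 0 then - s else if k = 1 then s else 0)"

text \<open>Eight equally likely outcomes produce the masses 1/8, 1/8 and 3/4. The sample space is
  the same for all \<open>s\<close>, so weak convergence as \<open>s\<close> tends to 0 reduces to
  pointwise convergence of \<open>three_point s\<close>.\<close>

definition three_point_measure :: "real \<Rightarrow> real measure" where
  "three_point_measure s = distr (measure_pmf (pmf_of_set {..<8::nat})) borel (three_point s)"

definition two_point_measure :: "real \<Rightarrow> real measure" where
  "two_point_measure s = distr (three_point_measure s) borel abs"

lemma real_distribution_three_point: "real_distribution (three_point_measure s)"
  unfolding three_point_measure_def
  by (intro prob_space.real_distribution_distr measure_pmf.prob_space_axioms) auto

lemma sets_three_point [simp, measurable_cong]: "sets (three_point_measure s) = sets borel"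
  and sets_two_point [simp, measurable_cong]: "sets (two_point_measure s) = sets borel"
  by (simp_all add: three_point_measure_def two_point_measure_def)

lemma real_distribution_two_point: "real_distribution (two_point_measure s)"
proof -
  interpret real_distribution "three_point_measure s"
    by (rule real_distribution_three_point)
  show ?thesis
    unfolding two_point_measure_def by (rule real_distribution_distr) simp
qed

lemma measure_three_point:
  assumes "A \<in> sets borel"
  shows "measure (three_point_measure s) A
    = indicator A (- s) / 8 + indicator A s / 8 + 3 / 4 * indicator A 0"
proof -
  have dom: "{..<8::nat} = {0, 1, 2, 3, 4, 5, 6, 7}"
    by auto
  have "measure (three_point_measure s) A
      = measure (measure_pmf (pmf_of_set {..<8::nat})) (three_point s -` A)"
    unfolding three_point_measure_def using assms by (subst measure_distr) auto
  also have "\<dots> = (\<Sum>k<8. indicator A (three_point s k)) / 8"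
    by (subst measure_pmf_of_set) (auto simp: indicator_def sum.If_cases lessThan_empty_iff vimage_def)
  also have "\<dots> = indicator A (- s) / 8 + indicator A s / 8 + 3 / 4 * indicator A 0"
    unfolding dom by (simp add: three_point_def)
  finally show ?thesis .
qed

lemma measure_two_point:
  assumes "A \<in> sets borel" "0 < s"
  shows "measure (two_point_measure s) A = indicator A s / 4 + 3 / 4 * indicator A 0"
proof -
  have "measure (two_point_measure s) A = measure (three_point_measure s) (abs -` A \<inter> UNIV)"
    unfolding two_point_measure_def using assms sets_eq_imp_space_eq[OF sets_three_point, of s]
    by (subst measure_distr) auto
  also have "abs -` A \<inter> UNIV \<in> sets borel"
    using measurable_sets[of abs borel borel A] assms by simp
  then have "measure (three_point_measure s) (abs -` A \<inter> UNIV)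
      = indicator A s / 4 + 3 / 4 * indicator A 0"
    using assms by (simp add: measure_three_point indicator_def)
  finally show ?thesis .
qed

section \<open>Couplings of the two marginals and their cost\<close>

lemma measure_coupling:
  assumes "P \<in> couplings M N" "A \<in> sets borel"
  shows "measure P {z. fst z \<in> A} = measure M A" "measure P {z. snd z \<in> A} = measure N A"
proof -
  have s: "sets P = sets borel" and M: "M = distr P borel fst" and N: "N = distr P borel snd"
    using assms by (auto simp: couplings_def)
  have sp: "space P = UNIV"
    using sets_eq_imp_space_eq[OF s] by simp
  have [measurable]: "fst \<in> measurable P borel" "snd \<in> measurable P borel"
    unfolding measurable_cong_sets[OF s refl]
    by (rule borel_measurable_continuous_onI; intro continuous_intros)+
  show "measure P {z. fst z \<in> A} = measure M A" "measure P {z. snd z \<in> A} = measure N A"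
    unfolding M N using assms(2) by (simp_all add: measure_distr sp vimage_def)
qed

lemma AE_coupling_support:
  assumes "P \<in> couplings (two_point_measure s) (three_point_measure s)" "0 < s"
  shows "AE z in P. z \<in> {0, s} \<times> {- s, 0, s}"
proof -
  interpret prob_space P
    using assms by (simp add: couplings_def)
  have "AE z in P. z \<in> {z. fst z \<in> {0, s}}" "AE z in P. z \<in> {z. snd z \<in> {- s, 0, s}}"
    using \<open>0 < s\<close> measure_coupling(1)[OF assms(1), of "{0, s}"]
      measure_coupling(2)[OF assms(1), of "{- s, 0, s}"]
    by (intro AE_prob_1; simp add: measure_two_point measure_three_point)+
  then show ?thesis
    by eventually_elim auto
qed

text \<open>The masses form a 2 by 3 table with prescribed row and column sums, which leaves two
  degrees of freedom. Both row sums and the column sums at \<open>s\<close> and \<open>- s\<close>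
  determine the other four entries.\<close>

lemma coupling_masses:
  assumes P: "P \<in> couplings (two_point_measure s) (three_point_measure s)" and "0 < s"
  defines "d \<equiv> measure P {(0, s)}" and "e \<equiv> measure P {(0, - s)}"
  shows "measure P {(s, s)} = 1 / 8 - d" "measure P {(s, - s)} = 1 / 8 - e"
    "measure P {(s, 0)} = d + e" "measure P {(0, 0)} = 3 / 4 - d - e"
proof -
  interpret prob_space P
    using P by (simp add: couplings_def)
  have s: "sets P = sets borel"
    using P by (auto simp: couplings_def)
  have meas: "{z. fst z \<in> A} \<in> sets P" "{z. snd z \<in> A} \<in> sets P"
    if "A \<in> sets borel" for A :: "real set"
  proof -
    have "{z. fst z \<in> A} = A \<times> (UNIV :: real set)" "{z. snd z \<in> A} = (UNIV :: real set) \<times> A"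
      by auto
    then show "{z. fst z \<in> A} \<in> sets P" "{z. snd z \<in> A} \<in> sets P"
      using that by (simp_all add: s borel_Times)
  qed
  let ?S = "{0, s} \<times> {- s, 0, s}"
  have sum: "measure P A = (\<Sum>z\<in>?S \<inter> A. measure P {z})" if "A \<in> sets P" for A
    using AE_coupling_support[OF P \<open>0 < s\<close>] that by (intro measure_finite_support) (auto simp: s)
  have eqs: "?S \<inter> {z. fst z \<in> {s}} = {(s, - s), (s, 0), (s, s)}"
    "?S \<inter> {z. fst z \<in> {0}} = {(0, - s), (0, 0), (0, s)}"
    "?S \<inter> {z. snd z \<in> {s}} = {(0, s), (s, s)}"
    "?S \<inter> {z. snd z \<in> {- s}} = {(0, - s), (s, - s)}"
    using \<open>0 < s\<close> by auto
  have "measure P {(s, - s)} + measure P {(s, 0)} + measure P {(s, s)} = 1 / 4"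
    "e + measure P {(0, 0)} + d = 3 / 4"
    "d + measure P {(s, s)} = 1 / 8" "e + measure P {(s, - s)} = 1 / 8"
    using sum[OF meas(1)[of "{s}"]] sum[OF meas(1)[of "{0}"]] sum[OF meas(2)[of "{s}"]]
      sum[OF meas(2)[of "{- s}"]] measure_coupling[OF P, of "{s}"] measure_coupling[OF P, of "{0}"]
      measure_coupling[OF P, of "{- s}"] \<open>0 < s\<close>
    unfolding eqs d_def e_def by (simp_all add: measure_two_point measure_three_point)
  then show "measure P {(s, s)} = 1 / 8 - d" "measure P {(s, - s)} = 1 / 8 - e"
    "measure P {(s, 0)} = d + e" "measure P {(0, 0)} = 3 / 4 - d - e"
    by linarith+
qed

text \<open>Squared differences are 0 or \<open>s\<^sup>2\<close> in the first coordinate and 0,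
  \<open>s\<^sup>2\<close> or \<open>4 * s\<^sup>2\<close> in the second, so the cost is
  \<open>s ^ 4\<close> times a quadratic form in the six masses, which the marginal constraints
  reduce to \<open>d\<close> and \<open>e\<close>.\<close>

lemma gw_cost_coupling:
  assumes P: "P \<in> couplings (two_point_measure s) (three_point_measure s)" and "0 < s"
  defines "d \<equiv> measure P {(0, s)}" and "e \<equiv> measure P {(0, - s)}"
  shows "gw_cost P = ennreal (s ^ 4 * (1 / 2 + 2 * (d + e) - 8 * (d - e)\<^sup>2))"
proof -
  interpret prob_space P
    using P by (simp add: couplings_def)
  have s: "sets P = sets borel"
    using P by (auto simp: couplings_def)
  let ?S = "{0, s} \<times> {- s, 0, s}"
  let ?c = "\<lambda>z w::real \<times> real. \<bar>(fst w - fst z)\<^sup>2 - (snd w - snd z)\<^sup>2\<bar>\<^sup>2"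
  \<comment> \<open>Used for the inner integral and then for the outer one, so that the remaining
    computation takes place in the reals.\<close>
  have int: "(\<integral>\<^sup>+z. ennreal (f z) \<partial>P) = ennreal (\<Sum>z\<in>?S. f z * measure P {z})"
    if "\<And>z. 0 \<le> f z" for f :: "real \<times> real \<Rightarrow> real"
  proof -
    have "(\<integral>\<^sup>+z. ennreal (f z) \<partial>P) = (\<Sum>z\<in>?S. ennreal (f z) * emeasure P {z})"
      using AE_coupling_support[OF P \<open>0 < s\<close>] by (intro nn_integral_finite_support) (auto simp: s)
    also have "\<dots> = (\<Sum>z\<in>?S. ennreal (f z * measure P {z}))"
      using that by (intro sum.cong) (auto simp: emeasure_eq_measure ennreal_mult)
    finally show ?thesis
      using that by (subst (asm) sum_ennreal) auto
  qed
  have "gw_cost P = (\<integral>\<^sup>+z. (\<integral>\<^sup>+w. ennreal (?c z w) \<partial>P) \<partial>P)"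
    unfolding gw_cost_def by (simp add: case_prod_unfold)
  also have "\<dots> = ennreal (\<Sum>z\<in>?S. (\<Sum>w\<in>?S. ?c z w * measure P {w}) * measure P {z})"
    by (subst int, simp, subst int) (auto intro!: sum_nonneg)
  also have "(\<Sum>z\<in>?S. (\<Sum>w\<in>?S. ?c z w * measure P {w}) * measure P {z})
      = s ^ 4 * (1 / 2 + 2 * (d + e) - 8 * (d - e)\<^sup>2)"
  proof -
    have S: "?S = {(0, - s), (0, 0), (0, s), (s, - s), (s, 0), (s, s)}"
      by auto
    have m: "measure P {(0, s)} = d" "measure P {(0, - s)} = e"
      "measure P {(s, s)} = 1 / 8 - d" "measure P {(s, - s)} = 1 / 8 - e"
      "measure P {(s, 0)} = d + e" "measure P {(0, 0)} = 3 / 4 - d - e"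
      using coupling_masses[OF P \<open>0 < s\<close>] by (simp_all add: d_def e_def)
    \<comment> \<open>These make the six atoms distinct, so that the double sum expands into one
      term per ordered pair.\<close>
    have [simp]: "s \<noteq> 0" "- s \<noteq> s" "s \<noteq> - s"
      using \<open>0 < s\<close> by auto
    show ?thesis
      unfolding S by (simp add: m) (simp add: power2_eq_square eval_nat_numeral field_simps)
  qed
  finally show ?thesis .
qed

section \<open>The optimal plan and its uniqueness\<close>

lemma coupling_abs_three_point:
  assumes "0 < s"
  defines "Q \<equiv> distr (three_point_measure s) borel (\<lambda>y. (\<bar>y\<bar>, y))"
  shows "Q \<in> couplings (two_point_measure s) (three_point_measure s)"
    and "gw_cost Q = ennreal (s ^ 4 / 2)"
proof -
  interpret N: real_distribution "three_point_measure s"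
    by (rule real_distribution_three_point)
  have [measurable]: "(\<lambda>y. (\<bar>y\<bar>, y)) \<in> borel_measurable (three_point_measure s)"
    by (simp add: borel_prod[symmetric])
  have "distr Q borel fst = two_point_measure s"
    unfolding Q_def two_point_measure_def
    by (subst distr_distr) (auto simp: comp_def borel_prod[symmetric])
  moreover have "distr Q borel snd = three_point_measure s"
    unfolding Q_def
    by (subst distr_distr) (auto simp: comp_def borel_prod[symmetric] intro!: distr_id2)
  ultimately show Q: "Q \<in> couplings (two_point_measure s) (three_point_measure s)"
    by (auto simp: couplings_def Q_def intro!: N.prob_space_distr)
  \<comment> \<open>Hence \<open>d = e = 0\<close> in the cost formula. The remaining
    \<open>s ^ 4 / 2\<close> comes from the two ordered pairs formed by \<open>(s, s)\<close> and
    \<open>(s, - s)\<close>, each of mass 1/64 and cost \<open>16 * s ^ 4\<close>.\<close>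
  have "(\<lambda>y. (\<bar>y\<bar>, y)) -` {(0, s)} = {}" "(\<lambda>y. (\<bar>y\<bar>, y)) -` {(0, - s)} = {}"
    using assms by auto
  then have "measure Q {(0, s)} = 0" "measure Q {(0, - s)} = 0"
    unfolding Q_def by (simp_all add: measure_distr)
  then show "gw_cost Q = ennreal (s ^ 4 / 2)"
    using gw_cost_coupling[OF Q] assms by simp
qed

text \<open>The bound 1/8 gives \<open>8 * \<bar>d - e\<bar> \<le> 1\<close>, so the concave term
  outweighs at most half of the linear one.\<close>

lemma coupling_excess:
  fixes d e :: real
  assumes "0 \<le> d" "0 \<le> e" "d \<le> 1 / 8" "e \<le> 1 / 8"
  shows "d + e \<le> 2 * (d + e) - 8 * (d - e)\<^sup>2"
proof -
  have "8 * (d - e)\<^sup>2 = 8 * \<bar>d - e\<bar> * \<bar>d - e\<bar>"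
    by (simp add: power2_eq_square)
  also have "\<dots> \<le> 1 * \<bar>d - e\<bar>"
    using assms by (intro mult_right_mono) (auto simp: abs_if)
  also have "\<dots> \<le> d + e"
    using assms by auto
  finally show ?thesis by simp
qed

text \<open>The excess over \<open>s ^ 4 / 2\<close> is at least linear in the mass moved to
  \<open>(0, s)\<close> and \<open>(0, - s)\<close>; this yields both minimality and
  uniqueness.\<close>

lemma gw_cost_coupling_ge:
  assumes P: "P \<in> couplings (two_point_measure s) (three_point_measure s)" and "0 < s"
  shows "ennreal (s ^ 4 * (1 / 2 + (measure P {(0, s)} + measure P {(0, - s)}))) \<le> gw_cost P"
proof -
  have "measure P {(0, s)} + measure P {(0, - s)} \<le> 2 * (measure P {(0, s)} + measure P {(0, - s)})
      - 8 * (measure P {(0, s)} - measure P {(0, - s)})\<^sup>2"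
    \<comment> \<open>Nonnegativity of the masses at \<open>(s, s)\<close> and
      \<open>(s, - s)\<close> bounds \<open>d\<close> and \<open>e\<close> by 1/8.\<close>
    using coupling_masses(1,2)[OF P \<open>0 < s\<close>] measure_nonneg[of P "{(s, s)}"]
      measure_nonneg[of P "{(s, - s)}"]
    by (intro coupling_excess) auto
  then show ?thesis
    unfolding gw_cost_coupling[OF P \<open>0 < s\<close>] using \<open>0 < s\<close>
    by (intro ennreal_leI mult_left_mono) auto
qed

text \<open>Ensures that the claim about all optimal plans is not vacuous.\<close>

lemma gw_optimal_plan_ex:
  assumes "0 < s"
  shows "\<exists>P. gw_optimal_plan (two_point_measure s) (three_point_measure s) P"
proof -
  define Q where "Q = distr (three_point_measure s) borel (\<lambda>y. (\<bar>y\<bar>, y))"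
  note Q = coupling_abs_three_point[OF assms, folded Q_def]
  have "gw_cost Q \<le> gw_cost P"
    if P: "P \<in> couplings (two_point_measure s) (three_point_measure s)" for P
  proof -
    have "s ^ 4 * (1 / 2) \<le> s ^ 4 * (1 / 2 + (measure P {(0, s)} + measure P {(0, - s)}))"
      using assms by (intro mult_left_mono) auto
    then show ?thesis
      using order_trans[OF ennreal_leI gw_cost_coupling_ge[OF P assms]] by (simp add: Q)
  qed
  then show ?thesis
    using Q by (auto simp: gw_optimal_plan_def is_arg_min_def not_less)
qed

text \<open>Comparison with the plan \<open>Q\<close> forces the linear excess to vanish, so the
  whole mass 1/8 at each of the heights \<open>s\<close> and \<open>- s\<close> sits over
  \<open>s\<close>.\<close>

lemma gw_optimal_plan_masses:
  assumes opt: "gw_optimal_plan (two_point_measure s) (three_point_measure s) P" and "0 < s"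
  shows "measure P {(s, s)} = 1 / 8" "measure P {(s, - s)} = 1 / 8"
proof -
  define Q where "Q = distr (three_point_measure s) borel (\<lambda>y. (\<bar>y\<bar>, y))"
  note Q = coupling_abs_three_point[OF \<open>0 < s\<close>, folded Q_def]
  let ?t = "measure P {(0, s)} + measure P {(0, - s)}"
  have P: "P \<in> couplings (two_point_measure s) (three_point_measure s)"
    and le: "gw_cost P \<le> gw_cost Q"
    using opt Q(1) by (auto simp: gw_optimal_plan_def is_arg_min_def not_less)
  have "ennreal (s ^ 4 * (1 / 2 + ?t)) \<le> ennreal (s ^ 4 / 2)"
    using order_trans[OF gw_cost_coupling_ge[OF P \<open>0 < s\<close>] le] unfolding Q(2) .
  \<comment> \<open>As \<open>ennreal\<close> truncates negative reals to 0, it reflects the order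
    only below a nonnegative right-hand side.\<close>
  moreover have "0 \<le> s ^ 4 / 2"
    by simp
  ultimately have "s ^ 4 * (1 / 2 + ?t) \<le> s ^ 4 / 2"
    using ennreal_le_iff by blast
  then have "s ^ 4 * ?t \<le> 0"
    by (simp add: distrib_left)
  then have "?t \<le> 0"
    using mult_pos_pos[of "s ^ 4" ?t] zero_less_power[OF \<open>0 < s\<close>, of 4] by linarith
  then have "measure P {(0, s)} = 0" "measure P {(0, - s)} = 0"
    using measure_nonneg[of P "{(0, s)}"] measure_nonneg[of P "{(0, - s)}"] by linarith+
  then show "measure P {(s, s)} = 1 / 8" "measure P {(s, - s)} = 1 / 8"
    using coupling_masses[OF P \<open>0 < s\<close>] by simp_all
qed

section \<open>Comparison with the monotone rearrangements\<close>

lemma quantile_two_point_gt: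
  assumes "0 < s" "0 < u" "u < 1" "quantile (two_point_measure s) u = s"
  shows "3 / 4 < u"
proof -
  \<comment> \<open>The quantile exceeds 0, so the level exceeds the cdf at 0, which is 3/4.\<close>
  have "u > cdf (two_point_measure s) 0"
    using quantile_le_iff[OF real_distribution_two_point assms(2,3), of s 0] assms(1,4) by simp
  then show ?thesis
    using assms(1) by (simp add: cdf_def measure_two_point)
qed

lemma gw_optimal_plan_not_monotone:
  assumes opt: "gw_optimal_plan (two_point_measure s) (three_point_measure s) P" and "0 < s"
  shows "P \<noteq> nondecreasing_rearrangement (two_point_measure s) (three_point_measure s)"
    and "P \<noteq> nonincreasing_rearrangement (two_point_measure s) (three_point_measure s)"
proof -
  note masses = gw_optimal_plan_masses[OF opt \<open>0 < s\<close>]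
  show "P \<noteq> nondecreasing_rearrangement (two_point_measure s) (three_point_measure s)"
  proof
    assume "P = nondecreasing_rearrangement (two_point_measure s) (three_point_measure s)"
    then obtain u where u: "0 < u" "u < 1" "quantile (two_point_measure s) u = s"
      "quantile (three_point_measure s) u = - s"
      using masses(2) unfolding nondecreasing_rearrangement_def
      by (auto simp: space_restrict_space elim!: distr_singleton_nonzeroE
          dest!: arg_cong[where f="\<lambda>P. measure P {(s, - s)} \<noteq> 0"])
    \<comment> \<open>The cdf of the three-point measure at \<open>- s\<close> is 1/8.\<close>
    have "u \<le> 1 / 8"
      using quantile_le_iff[OF real_distribution_three_point u(1,2), of s "- s"] u \<open>0 < s\<close>
      by (simp add: cdf_def measure_three_point)
    then show False
      using quantile_two_point_gt[OF \<open>0 < s\<close> u(1-3)] by simp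
  qed
  show "P \<noteq> nonincreasing_rearrangement (two_point_measure s) (three_point_measure s)"
  proof
    assume "P = nonincreasing_rearrangement (two_point_measure s) (three_point_measure s)"
    then obtain u where u: "0 < u" "u < 1" "quantile (two_point_measure s) u = s"
      "quantile (three_point_measure s) (1 - u) = s"
      using masses(1) unfolding nonincreasing_rearrangement_def
      by (auto simp: space_restrict_space elim!: distr_singleton_nonzeroE
          dest!: arg_cong[where f="\<lambda>P. measure P {(s, s)} \<noteq> 0"])
    \<comment> \<open>The quantile at \<open>1 - u\<close> exceeds 0, so \<open>1 - u\<close>
      exceeds the cdf at 0, which is 7/8.\<close>
    have "u < 1 / 8"
      using quantile_le_iff[OF real_distribution_three_point, of "1 - u" s 0] u \<open>0 < s\<close>
      by (simp add: cdf_def measure_three_point)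
    then show False
      using quantile_two_point_gt[OF \<open>0 < s\<close> u(1-3)] by simp
  qed
qed

section \<open>Symmetry of the limit and conclusion\<close>

lemma symmetric_measure_return: "symmetric_measure (return borel a)"
proof -
  have "integrable (return borel a) (\<lambda>x. x)"
    by (simp add: integrable_iff_bounded nn_integral_return)
  moreover have bary: "barycenter (return borel a) = a"
    by (simp add: barycenter_def integral_return)
  have "distr (return borel a) borel (\<lambda>x. 2 * a - x) = return borel (2 * a - a)"
    by (rule distr_return) simp_all
  then have "distr (return borel a) borel (\<lambda>x. 2 * barycenter (return borel a) - x) = return borel a"
    unfolding bary by simp
  ultimately show ?thesis
    unfolding symmetric_measure_def ..
qed

theorem proposition3p13:
  shows "\<exists>(\<mu> :: real measure) (\<nu> :: real measure)
            (\<mu>s :: nat \<Rightarrow> real measure) (\<nu>s :: nat \<Rightarrow> real measure).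
    real_distribution \<mu> \<and> symmetric_measure \<mu> \<and>
    real_distribution \<nu> \<and> symmetric_measure \<nu> \<and>
    (\<forall>n. real_distribution (\<mu>s n)) \<and> (\<forall>n. real_distribution (\<nu>s n)) \<and>
    weak_conv_m \<mu>s \<mu> \<and> weak_conv_m \<nu>s \<nu> \<and>
    (\<forall>n. (\<exists>\<pi>. gw_optimal_plan (\<mu>s n) (\<nu>s n) \<pi>) \<and>
         (\<forall>\<pi>. gw_optimal_plan (\<mu>s n) (\<nu>s n) \<pi> \<longrightarrow>
              \<pi> \<noteq> nondecreasing_rearrangement (\<mu>s n) (\<nu>s n) \<and>
              \<pi> \<noteq> nonincreasing_rearrangement (\<mu>s n) (\<nu>s n)))"
proof -
  \<comment> \<open>The successor keeps the scale positive at \<open>n = 0\<close>.\<close>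
  let ?s = "\<lambda>n. inverse (real (Suc n))"
  let ?D = "measure_pmf (pmf_of_set {..<8::nat})"
  have lim: "(\<lambda>n. three_point (?s n) k) \<longlonglongrightarrow> 0" for k
    using LIMSEQ_inverse_real_of_nat tendsto_minus[OF LIMSEQ_inverse_real_of_nat]
    by (cases "k = 0"; cases "k = 1") (simp_all add: three_point_def)
  have "weak_conv_m (\<lambda>n. three_point_measure (?s n)) (return borel 0)"
    unfolding three_point_measure_def
    using lim by (intro weak_conv_m_distr_return_0 measure_pmf.prob_space_axioms) auto
  \<comment> \<open>Both marginals live on the same eight-point space, so the convergence argument
    applies to the absolute values as well.\<close>
  moreover have "two_point_measure s = distr ?D borel (\<lambda>k. \<bar>three_point s k\<bar>)" for s
    unfolding two_point_measure_def three_point_measure_def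
    by (subst distr_distr) (auto simp: comp_def)
  then have "weak_conv_m (\<lambda>n. two_point_measure (?s n)) (return borel 0)"
    using tendsto_rabs_zero[OF lim]
    by (simp, intro weak_conv_m_distr_return_0 measure_pmf.prob_space_axioms) auto
  ultimately show ?thesis
    using real_distribution_return[of 0] symmetric_measure_return[of 0] real_distribution_two_point
      real_distribution_three_point gw_optimal_plan_ex gw_optimal_plan_not_monotone
    by (intro exI[of _ "return borel 0"] exI[of _ "\<lambda>n. two_point_measure (?s n)"]
        exI[of _ "\<lambda>n. three_point_measure (?s n)"]) auto
qed

end
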